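(* Let $\mathbb{E}_n$ ($n\geq5$) be the tree with $n$ vertices having one triple point and branches of size $1$, $2$ and $n-4$. The number of points over $\mathbb{F}_q$ on the varieties attached to $\mathbb{E}_n$ is given by $$N_{\mathbb{E}_n}=(q^2-q+1)\frac{q^{n-1}-1}{q-1}$$ if $n$ is even, and by $$N_{\mathbb{E}_n}^{\mathtt{versal}}=(q^2-q+1)(1+q^{n-1})$$ and $$N_{\mathbb{E}_n}^{\mathtt{generic}}=\frac{q^{n+1}-q^n+q^{n-1}-q^{(n+3)/2}-q^{(n-1)/2}+q^2-q+1}{q-1}$$ if $n$ is odd.
   Context: $\mathbb{E}_n$ has vertices $1,\dots,n$ and edges $1-2$, $2-4$, $3-4$, and $i-(i+1)$ for $4\leq i\leq n-1$. A tree is a finite connected simply-connected graph. A vertex cover of a tree $T$ is a set of vertices meeting every edge; a minimum vertex cover is one of minimal cardinality. Canonical coloring: a vertex of $T$ is green if it lies in all minimum vertex covers, orange if it lies in some but not all minimum vertex covers, red if it lies in none. A matching of $T$ is a set of edges (called dominoes) such that every vertex lies in at most one of them; a maximum matching is one of maximal cardinality. Known fact: every maximum matching covers all orange and green vertices, so uncovered vertices are red. The red-green components of $T$ are the connected components of the graph whose vertices are the red and green vertices of $T$ and whose edges are the edges of $T$ with one red end and one green end. For $\mathbb{E}_n$: if $n$ is even all vertices are orange; if $n$ is odd the vertices $1,2$ are orange, the vertex $3$ and the odd vertices $\geq5$ are red, the even vertices $\geq4$ are green, and there is exactly one red-green component. Varieties over $k=\mathbb{F}_q$: given $T$, a function $\phi$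 from the set of red-green components of $T$ to $\{\mathtt{generic},\mathtt{versal}\}$, a maximum matching $M$, and for every component $C$ with $\phi(C)=\mathtt{generic}$ and every vertex $u$ of $C$ not covered by $M$ a fixed value $\alpha_u\in k^\times$, $X^\phi_T$ is the affine scheme over $k$ with variables $x_i,x'_i$ for all vertices $i$ of $T$ and $\alpha_i$ for all vertices $i$ not covered by $M$ lying in components $C$ with $\phi(C)=\mathtt{versal}$, defined by the equations $x_ix'_i=1+\alpha_i\prod_{j} x_j$ for all vertices $i$ (product over the vertices $j$ adjacent to $i$) and the condition that all variables $\alpha_i$ are invertible; here $\alpha_i=1$ whenever $i$ is covered by $M$. When $\phi$ is constant one writes $X_T^{\mathtt{generic}}$, $X_T^{\mathtt{versal}}$, and simply $X_T$ if all vertices of $T$ are orange; $N_T^{\mathtt{generic}}$, $N_T^{\mathtt{versal}}$, $N_T$ denote the corresponding numbers of $\mathbb{F}_q$-points. Genericity condition (always assumed for every generic component $C$): a non-empty set $S$ of red vertices of $C$ is admissible if every green vertex of $C$ has either $0$ or $2$ neighbors in $S$. For every admissible set $S$ and every choice of signs $\varepsilon:S\to\{1,-1\}$ such that two distinct elements of $S$ sharing a common green neighbor have opposite signs, one requires $\prod_{i\in S}\alpha_i^{\varepsilon_i}\neq(-1)^{\#S}$. The generic formula holds for every choice of parameters satisfying this condition. *)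

theory Defs
  imports Complex_Main "HOL-Library.FuncSet" "HOL-Library.Cardinality"
begin

text \<open>A graph is a pair of a vertex set and a set of (two-element) edges. All notions below
  are meant for finite trees.\<close>

type_synonym 'v graph = "'v set \<times> 'v set set"

abbreviation verts :: "'v graph \<Rightarrow> 'v set" where "verts T \<equiv> fst T"
abbreviation edges :: "'v graph \<Rightarrow> 'v set set" where "edges T \<equiv> snd T"

definition neighbors :: "'v graph \<Rightarrow> 'v \<Rightarrow> 'v set" where
  "neighbors T i = {j \<in> verts T. {i, j} \<in> edges T}"


definition vertex_cover :: "'v graph \<Rightarrow> 'v set \<Rightarrow> bool" where
  "vertex_cover T S \<longleftrightarrow> S \<subseteq> verts T \<and> (\<forall>e\<in>edges T. S \<inter> e \<noteq> {})"

definition minimum_vertex_cover :: "'v graph \<Rightarrow> 'v set \<Rightarrow> bool" where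
  "minimum_vertex_cover T S \<longleftrightarrow>
     vertex_cover T S \<and> (\<forall>S'. vertex_cover T S' \<longrightarrow> card S \<le> card S')"

definition green :: "'v graph \<Rightarrow> 'v set" where
  "green T = {i \<in> verts T. \<forall>S. minimum_vertex_cover T S \<longrightarrow> i \<in> S}"

definition orange :: "'v graph \<Rightarrow> 'v set" where
  "orange T = {i \<in> verts T. (\<exists>S. minimum_vertex_cover T S \<and> i \<in> S)
                          \<and> (\<exists>S. minimum_vertex_cover T S \<and> i \<notin> S)}"

definition red :: "'v graph \<Rightarrow> 'v set" where
  "red T = {i \<in> verts T. \<forall>S. minimum_vertex_cover T S \<longrightarrow> i \<notin> S}"


definition red_green_adjacency :: "'v graph \<Rightarrow> ('v \<times> 'v) set" where
  "red_green_adjacency T =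
     {(i, j). {i, j} \<in> edges T \<and> (i \<in> red T \<and> j \<in> green T \<or> i \<in> green T \<and> j \<in> red T)}"

definition red_green_components :: "'v graph \<Rightarrow> 'v set set" where
  "red_green_components T = {(red_green_adjacency T)\<^sup>* `` {i} | i. i \<in> red T \<union> green T}"


definition matching :: "'v graph \<Rightarrow> 'v set set \<Rightarrow> bool" where
  "matching T M \<longleftrightarrow>
     M \<subseteq> edges T \<and> (\<forall>i\<in>verts T. \<forall>d\<in>M. \<forall>e\<in>M. i \<in> d \<longrightarrow> i \<in> e \<longrightarrow> d = e)"

definition maximum_matching :: "'v graph \<Rightarrow> 'v set set \<Rightarrow> bool" where
  "maximum_matching T M \<longleftrightarrow> matching T M \<and> (\<forall>M'. matching T M' \<longrightarrow> card M' \<le> card M)"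

definition uncovered :: "'v graph \<Rightarrow> 'v set set \<Rightarrow> 'v set" where
  "uncovered T M = verts T - \<Union>M"


datatype component_kind = Generic | Versal

definition versal_vertices ::
  "'v graph \<Rightarrow> ('v set \<Rightarrow> component_kind) \<Rightarrow> 'v set set \<Rightarrow> 'v set" where
  "versal_vertices T \<phi> M =
     {i \<in> uncovered T M. \<exists>C\<in>red_green_components T. i \<in> C \<and> \<phi> C = Versal}"

text \<open>The coefficient of the equation at \<open>i\<close>, given the fixed parameters \<open>\<alpha>\<close> (only consulted at
  uncovered vertices of generic components) and the invertible variables \<open>\<beta>\<close>.\<close>

definition coefficient ::
  "'v graph \<Rightarrow> ('v set \<Rightarrow> component_kind) \<Rightarrow> 'v set set \<Rightarrow> ('v \<Rightarrow> 'k::field) \<Rightarrow> ('v \<Rightarrow> 'k) \<Rightarrow> 'v \<Rightarrow> 'k"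
where
  "coefficient T \<phi> M \<alpha> \<beta> i =
     (if i \<notin> uncovered T M then 1
      else if i \<in> versal_vertices T \<phi> M then \<beta> i
      else \<alpha> i)"

text \<open>The set of \<open>k\<close>-rational points of the affine scheme, as the set of solutions
  \<open>(x, x', \<beta>)\<close> of its defining equations. Tuples indexed by a finite set are extensional
  functions on that set, so that each solution is counted once.\<close>

definition points ::
  "'v graph \<Rightarrow> ('v set \<Rightarrow> component_kind) \<Rightarrow> 'v set set \<Rightarrow> ('v \<Rightarrow> 'k::field)
     \<Rightarrow> (('v \<Rightarrow> 'k) \<times> ('v \<Rightarrow> 'k) \<times> ('v \<Rightarrow> 'k)) set" where
  "points T \<phi> M \<alpha> =
     {(x, x', \<beta>). x \<in> verts T \<rightarrow>\<^sub>E UNIV \<and> x' \<in> verts T \<rightarrow>\<^sub>E UNIV \<and>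
        \<beta> \<in> versal_vertices T \<phi> M \<rightarrow>\<^sub>E (UNIV - {0}) \<and>
        (\<forall>i\<in>verts T. x i * x' i = 1 + coefficient T \<phi> M \<alpha> \<beta> i * (\<Prod>j\<in>neighbors T i. x j))}"


definition admissible :: "'v graph \<Rightarrow> 'v set \<Rightarrow> 'v set \<Rightarrow> bool" where
  "admissible T C S \<longleftrightarrow>
     S \<noteq> {} \<and> S \<subseteq> C \<inter> red T \<and> (\<forall>g\<in>C \<inter> green T. card (neighbors T g \<inter> S) \<in> {0, 2})"

definition alternating_signs :: "'v graph \<Rightarrow> 'v set \<Rightarrow> 'v set \<Rightarrow> ('v \<Rightarrow> int) \<Rightarrow> bool" where
  "alternating_signs T C S \<epsilon> \<longleftrightarrow>
     (\<forall>i\<in>S. \<epsilon> i \<in> {1, -1}) \<and>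
     (\<forall>i\<in>S. \<forall>j\<in>S. i \<noteq> j \<longrightarrow> (\<exists>g\<in>C \<inter> green T. g \<in> neighbors T i \<inter> neighbors T j) \<longrightarrow> \<epsilon> i = - \<epsilon> j)"

text \<open>The fixed parameters are invertible and satisfy the genericity condition on every generic
  component; there the parameter at a covered vertex is \<open>1\<close> by convention.\<close>

definition generic_parameters ::
  "'v graph \<Rightarrow> ('v set \<Rightarrow> component_kind) \<Rightarrow> 'v set set \<Rightarrow> ('v \<Rightarrow> 'k::field) \<Rightarrow> bool" where
  "generic_parameters T \<phi> M \<alpha> \<longleftrightarrow>
     (\<forall>C\<in>red_green_components T. \<phi> C = Generic \<longrightarrow>
        (\<forall>u\<in>C \<inter> uncovered T M. \<alpha> u \<noteq> 0) \<and>
        (\<forall>S \<epsilon>. admissible T C S \<longrightarrow> alternating_signs T C S \<epsilon> \<longrightarrow>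
           (\<Prod>i\<in>S. (if i \<in> uncovered T M then \<alpha> i else 1) powi \<epsilon> i) \<noteq> (-1) ^ card S))"


definition E_graph :: "nat \<Rightarrow> nat graph" where
  "E_graph n = ({1..n}, {{1, 2}, {2, 4}, {3, 4}} \<union> {{i, i + 1} | i. 4 \<le> i \<and> i < n})"

end

theory Submission
  imports Defs
begin

text \<open>
  A vertex \<open>i\<close> with \<open>x\<^sub>i \<noteq> 0\<close> determines \<open>x'\<^sub>i\<close>; one with \<open>x\<^sub>i = 0\<close> leaves \<open>x'\<^sub>i\<close> free but forces
  \<open>1 + \<alpha>\<^sub>i \<Prod> x\<^sub>j = 0\<close>. So the number of points is a weighted sum over \<open>x\<close>, which along a path obeys a
  two-step recursion: below a vertex with value \<open>y \<noteq> 0\<close> a path of even length contributes a constant,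
  and a path of odd length a constant plus a jump at one particular value of \<open>y\<close>. Splitting the sum at
  the triple point according to whether \<open>x\<^sub>4 = 0\<close>, the jumps of the branch \<open>{3}\<close> and of the branch
  \<open>{5..n}\<close> coincide exactly when the parameter equals \<open>(-1)\<^bsup>(n-1)/2\<^esup>\<close>, which is what genericity
  excludes; in the versal case one sums over all parameters and meets this value once.

  On the side of the graph, \<open>{2, 4, 6, \<dots>}\<close> and \<open>{1, 4, 6, \<dots>}\<close> are vertex covers of the size of a
  maximum matching, so an uncovered vertex avoids both and hence is odd and at least \<open>3\<close>.
\<close>

section \<open>Reduction to a weighted sum\<close>

lemma sum_PiE_insert:
  assumes "a \<notin> A"
  shows "(\<Sum>x\<in>insert a A \<rightarrow>\<^sub>E B. F x) = (\<Sum>x\<in>A \<rightarrow>\<^sub>E B. \<Sum>t\<in>B. F (x(a := t)))"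
proof -
  have "(\<Sum>x\<in>insert a A \<rightarrow>\<^sub>E B. F x) = (\<Sum>(t, x)\<in>B \<times> (A \<rightarrow>\<^sub>E B). F (x(a := t)))"
    unfolding PiE_insert_eq
    by (subst sum.reindex[OF inj_combinator[OF assms]]) (simp add: case_prod_unfold)
  also have "\<dots> = (\<Sum>t\<in>B. \<Sum>x\<in>A \<rightarrow>\<^sub>E B. F (x(a := t)))"
    by (rule sum.cartesian_product[symmetric])
  finally show ?thesis by (subst sum.swap)
qed

definition fibre :: "'k::{field,finite} \<Rightarrow> 'k \<Rightarrow> real" where
  "fibre a b = real (card {t. a * t = b})"

lemma fibre_nonzero [simp]:
  assumes "a \<noteq> 0"
  shows "fibre a b = 1"
proof -
  have "{t. a * t = b} = {b / a}" using assms by (auto simp: field_simps)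
  then show ?thesis by (simp add: fibre_def)
qed

lemma fibre_zero: "fibre (0::'k::{field,finite}) b = (if b = 0 then real CARD('k) else 0)"
  by (simp add: fibre_def)

text \<open>The variables \<open>x'\<close> are already counted out through \<open>fibre\<close>.
  Leaving \<open>c\<close> arbitrary lets one sum serve both fixed parameters and versal
  ones.\<close>

definition graph_weight :: "'v graph \<Rightarrow> ('v \<Rightarrow> 'k::{field,finite}) \<Rightarrow> real" where
  "graph_weight T c =
     (\<Sum>x\<in>verts T \<rightarrow>\<^sub>E UNIV. \<Prod>i\<in>verts T. fibre (x i) (1 + c i * (\<Prod>j\<in>neighbors T i. x j)))"

text \<open>Once \<open>x\<close> and the invertible variables are fixed, each \<open>x' i\<close>
  occurs in its own equation only, so the solutions \<open>x'\<close> form a product set whose size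
  is a product of fibres.\<close>

lemma card_points:
  fixes \<alpha> :: "'v \<Rightarrow> 'k::{field,finite}"
  assumes fin: "finite (verts T)"
  shows "real (card (points T \<phi> M \<alpha>)) =
    (\<Sum>\<beta>\<in>versal_vertices T \<phi> M \<rightarrow>\<^sub>E (UNIV - {0}). graph_weight T (coefficient T \<phi> M \<alpha> \<beta>))"
proof -
  define B where "B = (versal_vertices T \<phi> M \<rightarrow>\<^sub>E (UNIV - {0::'k}))"
  define X where "X = (verts T \<rightarrow>\<^sub>E (UNIV :: 'k set))"
  define P where "P \<beta> x = (PiE (verts T)
     (\<lambda>i. {t. x i * t = 1 + coefficient T \<phi> M \<alpha> \<beta> i * (\<Prod>j\<in>neighbors T i. x j)}))" for \<beta> x
  have "versal_vertices T \<phi> M \<subseteq> verts T"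
    by (auto simp: versal_vertices_def uncovered_def)
  then have finB: "finite B" unfolding B_def
    using fin finite_subset by (intro finite_PiE) auto
  have finX: "finite X" unfolding X_def using fin by (intro finite_PiE) auto
  have finP: "finite (P \<beta> x)" for \<beta> x unfolding P_def using fin by (intro finite_PiE) auto
  \<comment> \<open>Reordering the triple lists the choices by dependence: first \<beta>, then
    \<open>x\<close>, then \<open>x'\<close>.\<close>
  have eq: "points T \<phi> M \<alpha>
      = (\<lambda>(\<beta>, x, x'). (x, x', \<beta>)) ` (SIGMA \<beta>:B. SIGMA x:X. P \<beta> x)"
    unfolding points_def B_def X_def P_def
    by (auto simp: image_iff PiE_iff)
  have "card (points T \<phi> M \<alpha>) = card (SIGMA \<beta>:B. SIGMA x:X. P \<beta> x)"
    unfolding eq by (rule card_image) (auto simp: inj_on_def)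
  also have "\<dots> = (\<Sum>\<beta>\<in>B. \<Sum>x\<in>X. card (P \<beta> x))"
    using finB finX finP by (simp add: card_SigmaI)
  finally show ?thesis
    by (simp add: graph_weight_def fibre_def P_def card_PiE fin B_def X_def)
qed

section \<open>Paths\<close>

text \<open>The path is entered through an edge with end values \<open>y\<close> (outside) and \<open>z\<close>; it is continued
  beyond its last vertex by an imaginary vertex of value \<open>1\<close>, so that all its equations have the
  same shape.\<close>

fun path_weight :: "'k::{field,finite} list \<Rightarrow> 'k \<Rightarrow> 'k \<Rightarrow> real" where
  "path_weight [] y z = of_bool (z = 1)"
| "path_weight (c # cs) y z = (\<Sum>t\<in>UNIV. fibre z (1 + c * y * t) * path_weight cs z t)"

definition path_count :: "'k::{field,finite} list \<Rightarrow> 'k \<Rightarrow> real" where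
  "path_count cs y = (\<Sum>z\<in>UNIV. path_weight cs y z)"

lemma path_weight_single [simp]: "path_weight [c] y z = fibre z (1 + c * y)"
  by (simp add: of_bool_def if_distrib[of "\<lambda>r. _ * r"] cong: if_cong)

text \<open>A nonzero value at the first vertex makes its fibre a single point, so \<open>c\<close>
  and \<open>y\<close> drop out and the rest of the path sees \<open>z\<close> as its outside
  value.\<close>

lemma path_weight_Cons_nonzero: "z \<noteq> 0 \<Longrightarrow> path_weight (c # cs) y z = path_count cs z"
  by (simp add: path_count_def)

text \<open>A zero at the first vertex leaves its \<open>x'\<close> free, hence the factor
  \<open>CARD('k)\<close>, and forces the next value.\<close>

lemma path_weight_Cons_zero:
  fixes c :: "'k::{field,finite}"
  assumes "c \<noteq> 0" "y \<noteq> 0"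
  shows "path_weight (c # cs) y 0 = real CARD('k) * path_weight cs 0 (- 1 / (c * y))"
proof -
  have "1 + c * y * t = 0 \<longleftrightarrow> t = - 1 / (c * y)" for t
    using assms by (simp add: field_simps eq_neg_iff_add_eq_0)
  then show ?thesis
    by (simp add: fibre_zero if_distrib[of "\<lambda>r. r * _"] cong: if_cong)
qed

lemma sum_UNIV_split_zero:
  fixes f :: "'k::{field,finite} \<Rightarrow> real"
  shows "(\<Sum>z\<in>UNIV. f z) = (\<Sum>z\<in>UNIV - {0}. f z) + f 0"
  by (simp add: sum.remove[of UNIV 0])

text \<open>The first vertex is nonzero or zero. In the second case the forced next value is
  nonzero, so for nonempty \<open>cs\<close> the last term involves \<open>path_count\<close> of the
  tail of \<open>cs\<close>: this is the two-step recursion.\<close>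

lemma path_count_Cons:
  fixes c :: "'k::{field,finite}"
  assumes "c \<noteq> 0" "y \<noteq> 0"
  shows "path_count (c # cs) y =
    (\<Sum>z\<in>UNIV - {0}. path_count cs z) + real CARD('k) * path_weight cs 0 (- 1 / (c * y))"
proof -
  have "path_count (c # cs) y
      = (\<Sum>z\<in>UNIV - {0}. path_weight (c # cs) y z) + path_weight (c # cs) y 0"
    unfolding path_count_def by (rule sum_UNIV_split_zero)
  also have "(\<Sum>z\<in>UNIV - {0}. path_weight (c # cs) y z) = (\<Sum>z\<in>UNIV - {0}. path_count cs z)"
    by (intro sum.cong refl path_weight_Cons_nonzero) auto
  finally show ?thesis using path_weight_Cons_zero[OF assms] by simp
qed

text \<open>The value next to a path of odd length at which its number of points jumps (meaningless for
  even length).\<close>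

fun resonance :: "'k::field list \<Rightarrow> 'k" where
  "resonance [] = 1"
| "resonance [c] = - 1 / c"
| "resonance (c # d # cs) = - 1 / (c * resonance cs)"

lemma resonance_nonzero: "0 \<notin> set cs \<Longrightarrow> resonance cs \<noteq> 0"
  by (induction cs rule: resonance.induct) auto

lemma card_nonzero: "real (card (UNIV - {0::'k::{field,finite}})) = real CARD('k) - 1"
  by (simp add: card_Diff_singleton of_nat_diff Suc_leI)

lemma card_field_ge_2: "real CARD('k::{field,finite}) \<ge> 2"
proof -
  have "card {0, 1::'k} \<le> CARD('k)" by (rule card_mono) auto
  then show ?thesis by simp
qed

section \<open>Identities between rational functions of \<open>q\<close>\<close>

context
  fixes q :: real
  assumes q: "q \<ge> 2"
begin

lemma q_sq: "q\<^sup>2 - 1 \<noteq> 0"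
  using power_mono[OF q, of 2] by simp

text \<open>Recursion for even length: the odd counts summed over \<open>q - 1\<close> nonzero
  values, their jump \<open>q^(k+1)\<close> met once, plus \<open>q\<close> times the shorter even
  count.\<close>

lemma even_step:
  "(q - 1) * ((q^(k+2) - 1) * (q^(k+1) - 1) / (q\<^sup>2 - 1)) + q^(k+1)
     + q * ((q^(2*k+2) - 1) / (q\<^sup>2 - 1)) = (q^(2*(k+1)+2) - 1) / (q\<^sup>2 - 1)"
proof -
  \<comment> \<open>With \<open>Q\<close> for \<open>q^k\<close>, clearing denominators leaves a
    polynomial identity in \<open>q\<close> and \<open>Q\<close>.\<close>
  define Q where "Q = q^k"
  have "q^(2*k) = Q\<^sup>2" by (simp add: Q_def power_mult mult.commute power_even_eq)
  then show ?thesis using q_sq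
    by (simp add: divide_simps power_add Q_def[symmetric]) (simp add: algebra_simps power2_eq_square)
qed

text \<open>The triple point for \<open>n = 2 * k + 6\<close>: the first summand collects the
  nonzero values at vertex 4, the second the value zero.\<close>

lemma even_total:
  "(q\<^sup>2 + 1) * (q\<^sup>2 - q + 1) * ((q^(2*k+4) - 1) / (q\<^sup>2 - 1))
     + q * (q\<^sup>2 - q + 1) * ((q - 1) * ((q^(k+2) - 1) * (q^(k+1) - 1) / (q\<^sup>2 - 1)) + q^(k+1))
   = (q\<^sup>2 - q + 1) * ((q^(2*k+5) - 1) / (q - 1))"
proof -
  define Q where "Q = q^k"
  have 1: "q^(2*k) = Q\<^sup>2" by (simp add: Q_def power_mult mult.commute power_even_eq)
  have 2: "q\<^sup>2 - 1 = (q - 1) * (q + 1)" by (simp add: algebra_simps power2_eq_square)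
  have "q - 1 \<noteq> 0" "q + 1 \<noteq> 0" using q by auto
  then show ?thesis unfolding 2
    by (simp add: divide_simps power_add Q_def[symmetric] 1)
      (simp add: algebra_simps power2_eq_square eval_nat_numeral)
qed

text \<open>The same split for \<open>n = 2 * k + 5\<close>, without the extra term that appears
  when the jumps of two branches coincide.\<close>

lemma odd_total:
  "(q\<^sup>2 + 1) * ((q\<^sup>2 - q + 1) * ((q^(k+2) - 1) * (q^(k+1) - 1) / (q\<^sup>2 - 1)) + (q - 1) * q^(k+1))
     + q * (q\<^sup>2 - q + 1) * ((q - 1) * ((q^(2*k+2) - 1) / (q\<^sup>2 - 1)))
   = (q^(2*k+6) - q^(2*k+5) + q^(2*k+4) - q^(k+4) - q^(k+2) + q\<^sup>2 - q + 1) / (q - 1)"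
proof -
  define Q where "Q = q^k"
  have 1: "q^(2*k) = Q\<^sup>2" by (simp add: Q_def power_mult mult.commute power_even_eq)
  have 2: "q\<^sup>2 - 1 = (q - 1) * (q + 1)" by (simp add: algebra_simps power2_eq_square)
  have "q - 1 \<noteq> 0" "q + 1 \<noteq> 0" using q by auto
  then show ?thesis unfolding 2
    by (simp add: divide_simps power_add Q_def[symmetric] 1)
      (simp add: algebra_simps power2_eq_square eval_nat_numeral)
qed

lemma odd_step:
  "(q - 1) * ((q^(2*(k+1)+2) - 1) / (q\<^sup>2 - 1))
     + q * ((q^(k+2) - 1) * (q^(k+1) - 1) / (q\<^sup>2 - 1))
   = (q^(k+3) - 1) * (q^(k+2) - 1) / (q\<^sup>2 - 1)"
proof -
  define Q where "Q = q^k"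
  have "q^(2*k) = Q\<^sup>2" by (simp add: Q_def power_mult mult.commute power_even_eq)
  then show ?thesis using q_sq
    by (simp add: divide_simps power_add Q_def[symmetric])
      (simp add: algebra_simps power2_eq_square eval_nat_numeral)
qed

end

text \<open>Behind a zero vertex the path is entered with value \<open>- 1 / (c * y)\<close>.
  Solving for \<open>y\<close> when this is the resonance \<open>s\<close> of the remaining path
  gives the recursion of \<open>resonance\<close>.\<close>

lemma minus_one_divide_eq_iff:
  fixes c y s :: "'k::field"
  assumes "c \<noteq> 0" "y \<noteq> 0" "s \<noteq> 0"
  shows "- 1 / (c * y) = s \<longleftrightarrow> y = - 1 / (c * s)"
proof -
  have "- 1 / (c * y) = s \<longleftrightarrow> - 1 = s * (c * y)"
    using assms by (intro nonzero_divide_eq_eq) simp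
  also have "s * (c * y) = y * (c * s)" by (simp only: mult_ac)
  also have "- 1 = y * (c * s) \<longleftrightarrow> y = - 1 / (c * s)"
    using assms by (subst nonzero_eq_divide_eq) auto
  finally show ?thesis .
qed

text \<open>Both parities go through one induction. An even count sums odd counts over all nonzero
  values, so the jump is met once whatever \<open>y\<close> is; an odd count inherits the jump of
  the path shorter by two, multiplied by \<open>q\<close>.\<close>

lemma path_count_closed_form:
  fixes cs :: "'k::{field,finite} list" and q :: real
  assumes q_def: "q = real CARD('k)" and "0 \<notin> set cs" "y \<noteq> 0"
  shows "length cs = 2 * k \<Longrightarrow> path_count cs y = (q^(2*k+2) - 1) / (q\<^sup>2 - 1)"
    and "length cs = 2 * k + 1 \<Longrightarrow> path_count cs y =
      (q^(k+2) - 1) * (q^(k+1) - 1) / (q\<^sup>2 - 1) + (if y = resonance cs then q^(k+1) else 0)"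
  using assms(2,3)
proof (induction k arbitrary: cs y)
  have q2: "q \<ge> 2" unfolding q_def by (rule card_field_ge_2)
  case 0
  {
    case 1
    then show ?case using q_sq[OF q2] by (simp add: path_count_def of_bool_def) (simp add: power2_eq_square)
  next
    case 2
    obtain c where c: "cs = [c]" using 2(1) by (cases cs) auto
    then have nz: "c \<noteq> 0" using 2(2) by auto
    \<comment> \<open>The imaginary vertex has value 1, which places the jump of a one-vertex path
      at \<open>- 1 / c\<close>.\<close>
    have "path_weight [] 0 (- 1 / (c * y)) = (if y = - 1 / c then 1 else 0)"
      using minus_one_divide_eq_iff[OF nz \<open>y \<noteq> 0\<close> one_neq_zero] by simp
    moreover have "path_count [] z = 1" for z :: 'k by (simp add: path_count_def of_bool_def)
    ultimately have "path_count cs y = q - 1 + (if y = - 1 / c then q else 0)"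
      unfolding c path_count_Cons[OF nz \<open>y \<noteq> 0\<close>] by (simp add: card_nonzero q_def)
    then show ?case using q_sq[OF q2] unfolding c by (simp add: power2_eq_square)
  }
next
  have q2: "q \<ge> 2" unfolding q_def by (rule card_field_ge_2)
  case (Suc k)
  \<comment> \<open>Stated for every list, because the odd case at \<open>Suc k\<close> applies it
    to the path without its first vertex.\<close>
  have even: "path_count cs y = (q^(2*(k+1)+2) - 1) / (q\<^sup>2 - 1)"
    if len: "length cs = 2 * Suc k" and "0 \<notin> set cs" "y \<noteq> 0" for cs and y :: 'k
  proof -
    obtain c d ds where cs: "cs = c # d # ds" "length ds = 2 * k"
      using len by (auto simp: length_Suc_conv)
    have nz: "c \<noteq> 0" "0 \<notin> set (d # ds)" using cs that by auto
    \<comment> \<open>The second vertex carries this nonzero value, so its coefficient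
      \<open>d\<close> has no influence and \<open>ds\<close> is entered directly.\<close>
    have neg: "- 1 / (c * y) \<noteq> 0" using nz \<open>y \<noteq> 0\<close> by simp
    have "path_count cs y = (\<Sum>z\<in>UNIV - {0}. path_count (d # ds) z) + q * path_count ds (- 1 / (c * y))"
      unfolding cs path_count_Cons[OF nz(1) \<open>y \<noteq> 0\<close>] path_weight_Cons_nonzero[OF neg]
      by (simp add: q_def)
    also have "(\<Sum>z\<in>UNIV - {0}. path_count (d # ds) z) = (\<Sum>z\<in>UNIV - {0}.
        (q^(k+2) - 1) * (q^(k+1) - 1) / (q\<^sup>2 - 1) + (if z = resonance (d # ds) then q^(k+1) else 0))"
      using cs nz by (intro sum.cong refl Suc.IH(2)) auto
    also have "\<dots> = (q - 1) * ((q^(k+2) - 1) * (q^(k+1) - 1) / (q\<^sup>2 - 1)) + q^(k+1)"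
      \<comment> \<open>The resonance is one of the nonzero values, so the jump is counted exactly
        once.\<close>
      using resonance_nonzero[OF nz(2)]
      by (simp add: sum.distrib card_nonzero q_def[symmetric])
    also have "path_count ds (- 1 / (c * y)) = (q^(2*k+2) - 1) / (q\<^sup>2 - 1)"
      using cs nz neg by (intro Suc.IH(1)) auto
    finally show ?thesis using even_step[OF q2, of k] by simp
  qed
  {
    case 1
    then show ?case using even by simp
  next
    case 2
    obtain c d ds where cs: "cs = c # d # ds" "length ds = 2 * k + 1"
      using 2 by (auto simp: length_Suc_conv)
    have nz: "c \<noteq> 0" "0 \<notin> set (d # ds)" using cs 2 by auto
    have neg: "- 1 / (c * y) \<noteq> 0" using nz \<open>y \<noteq> 0\<close> by simp
    have "path_count cs y = (\<Sum>z\<in>UNIV - {0}. path_count (d # ds) z) + q * path_count ds (- 1 / (c * y))"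
      unfolding cs path_count_Cons[OF nz(1) \<open>y \<noteq> 0\<close>] path_weight_Cons_nonzero[OF neg]
      by (simp add: q_def)
    also have "(\<Sum>z\<in>UNIV - {0}. path_count (d # ds) z) =
        (\<Sum>z\<in>UNIV - {0::'k}. (q^(2*(k+1)+2) - 1) / (q\<^sup>2 - 1))"
      using cs nz by (intro sum.cong refl even) auto
    also have "\<dots> = (q - 1) * ((q^(2*(k+1)+2) - 1) / (q\<^sup>2 - 1))"
      by (simp add: card_nonzero q_def[symmetric])
    also have "path_count ds (- 1 / (c * y)) = (q^(k+2) - 1) * (q^(k+1) - 1) / (q\<^sup>2 - 1)
        + (if - 1 / (c * y) = resonance ds then q^(k+1) else 0)"
      using cs nz neg by (intro Suc.IH(2)) auto
    also have "- 1 / (c * y) = resonance ds \<longleftrightarrow> y = resonance cs"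
      using nz \<open>y \<noteq> 0\<close> resonance_nonzero[of ds] cs minus_one_divide_eq_iff[of c y "resonance ds"]
      by (cases ds) auto
    finally have "path_count cs y = (q^(k+3) - 1) * (q^(k+2) - 1) / (q\<^sup>2 - 1)
        + (if y = resonance cs then q * q^(k+1) else 0)"
      unfolding odd_step[OF q2, of k, symmetric] by (simp add: distrib_left)
    then show ?case by (simp add: eval_nat_numeral)
  }
qed

section \<open>Counting on \<open>E\<^sub>n\<close>\<close>

lemma verts_E_graph [simp]: "verts (E_graph n) = {1..n}"
  by (simp add: E_graph_def)

text \<open>Adjacency as linear arithmetic, so that neighbourhoods and covers can be settled by
  \<open>presburger\<close>.\<close>

lemma E_graph_edge_iff:
  "{i, j} \<in> edges (E_graph n) \<longleftrightarrow>
     i = 1 \<and> j = 2 \<or> i = 2 \<and> j = 1 \<or> i = 2 \<and> j = 4 \<or> i = 4 \<and> j = 2 \<or> i = 3 \<and> j = 4 \<or> i = 4 \<and> j = 3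
     \<or> 4 \<le> i \<and> i < n \<and> j = i + 1 \<or> 4 \<le> j \<and> j < n \<and> i = j + 1"
proof -
  have "(\<exists>a. {i, j} = {a, a + 1} \<and> 4 \<le> a \<and> a < n) \<longleftrightarrow>
      4 \<le> i \<and> i < n \<and> j = i + 1 \<or> 4 \<le> j \<and> j < n \<and> i = j + 1"
    by (auto simp: doubleton_eq_iff conj_disj_distribR ex_disj_distrib)
  then show ?thesis
    unfolding E_graph_def snd_conv Un_iff mem_Collect_eq insert_iff doubleton_eq_iff empty_iff by argo
qed

lemma neighbors_E_graph:
  assumes "5 \<le> n"
  shows "neighbors (E_graph n) (Suc 0) = {2}" "neighbors (E_graph n) 2 = {1, 4}"
    "neighbors (E_graph n) 3 = {4}" "neighbors (E_graph n) 4 = {2, 3, 5}"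
    "5 \<le> i \<Longrightarrow> i < n \<Longrightarrow> neighbors (E_graph n) i = {i - 1, i + 1}"
    "neighbors (E_graph n) n = {n - 1}"
  unfolding neighbors_def E_graph_edge_iff verts_E_graph using assms
  by (simp_all only: set_eq_iff mem_Collect_eq insert_iff empty_iff atLeastAtMost_iff; presburger)+

lemma neighbors_E_graph_Suc:
  assumes "5 \<le> n" "i < n"
  shows "neighbors (E_graph (Suc n)) i = neighbors (E_graph n) i"
  unfolding neighbors_def E_graph_edge_iff verts_E_graph using assms
  by (simp only: set_eq_iff mem_Collect_eq insert_iff empty_iff atLeastAtMost_iff; presburger)

text \<open>The equation at the last vertex is replaced by \<open>g\<close>, which stands for everything that has been
  summed out beyond it.\<close>

definition truncated_weight ::
  "(nat \<Rightarrow> 'k::{field,finite}) \<Rightarrow> nat \<Rightarrow> ('k \<Rightarrow> 'k \<Rightarrow> real) \<Rightarrow> real" where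
  "truncated_weight c n g =
     (\<Sum>x\<in>{1..n} \<rightarrow>\<^sub>E UNIV.
        (\<Prod>i\<in>{1..<n}. fibre (x i) (1 + c i * (\<Prod>j\<in>neighbors (E_graph n) i. x j)))
          * g (x (n - 1)) (x n))"

lemma graph_weight_eq_truncated_weight:
  assumes "5 \<le> n"
  shows "graph_weight (E_graph n) c = truncated_weight c n (path_weight [c n])"
proof -
  have "{1..n} = insert n {1..<n}" using assms by auto
  then show ?thesis
    using neighbors_E_graph(6)[OF assms]
    by (simp add: graph_weight_def truncated_weight_def E_graph_def[of n] mult.commute
        del: path_weight.simps)
qed

text \<open>The value at \<open>Suc n\<close> occurs only in the equation at \<open>n\<close>, whose
  neighbours are \<open>n - 1\<close> and \<open>Suc n\<close>, and in
  \<open>path_weight cs\<close>. Summing it out is one unfolding of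
  \<open>path_weight\<close>.\<close>

lemma truncated_weight_Suc:
  assumes n: "5 \<le> n"
  shows "truncated_weight c (Suc n) (path_weight cs) = truncated_weight c n (path_weight (c n # cs))"
proof -
  define W where "W m x i = fibre (x i) (1 + c i * (\<Prod>j\<in>neighbors (E_graph m) i. x j))" for m x i
  have W_last: "W (Suc n) (x(Suc n := t)) n = fibre (x n) (1 + c n * x (n - 1) * t)" for x t
    using n neighbors_E_graph(5)[of "Suc n" n] by (simp add: W_def mult.assoc)
  have W_old: "W (Suc n) (x(Suc n := t)) i = W n x i" if "i < n" for x t i
  proof -
    have "(\<Prod>j\<in>neighbors (E_graph n) i. (x(Suc n := t)) j) = (\<Prod>j\<in>neighbors (E_graph n) i. x j)"
      by (intro prod.cong) (auto simp: neighbors_def E_graph_def)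
    then show ?thesis using that neighbors_E_graph_Suc[OF n that] by (simp add: W_def)
  qed
  have old: "(\<Prod>i\<in>{1..<n}. W (Suc n) (x(Suc n := t)) i) = (\<Prod>i\<in>{1..<n}. W n x i)" for x t
    by (intro prod.cong) (auto simp: W_old)
  have ins: "{1..Suc n} = insert (Suc n) {1..n}" "{1..<Suc n} = insert n {1..<n}" using n by auto
  have "truncated_weight c (Suc n) (path_weight cs)
      = (\<Sum>x\<in>{1..n} \<rightarrow>\<^sub>E UNIV. \<Sum>t\<in>UNIV. (\<Prod>i\<in>{1..<Suc n}. W (Suc n) (x(Suc n := t)) i)
          * path_weight cs (x n) t)"
    unfolding truncated_weight_def W_def[symmetric] ins(1)
    by (subst sum_PiE_insert) (simp_all add: W_def)
  also have "\<dots> = (\<Sum>x\<in>{1..n} \<rightarrow>\<^sub>E UNIV. (\<Prod>i\<in>{1..<n}. W n x i)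
      * (\<Sum>t\<in>UNIV. fibre (x n) (1 + c n * x (n - 1) * t) * path_weight cs (x n) t))"
    unfolding ins(2) by (simp add: W_last old sum_distrib_left mult_ac del: One_nat_def)
  finally show ?thesis
    by (simp add: truncated_weight_def W_def)
qed

lemma graph_weight_eq_truncated_weight_5:
  assumes "5 \<le> n"
  shows "graph_weight (E_graph n) c = truncated_weight c 5 (path_weight (map c [5..<n+1]))"
proof -
  have "truncated_weight c m (path_weight (map c [m..<n+1]))
      = truncated_weight c 5 (path_weight (map c [5..<n+1]))" if "5 \<le> m" "m \<le> n" for m
    using that
  proof (induction m rule: dec_induct)
    case (step m)
    have "[m..<n+1] = m # [Suc m..<n+1]" using step by (simp add: upt_conv_Cons)
    then show ?case using step truncated_weight_Suc[of m c "map c [Suc m..<n+1]"]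
      by (simp del: path_weight.simps upt_Suc)
  qed simp
  from this[of n] show ?thesis
    using assms graph_weight_eq_truncated_weight[OF assms, of c] by (simp del: path_weight.simps)
qed

text \<open>Here \<open>y\<close>, \<open>z\<close>, \<open>v\<close>, \<open>u\<close> are the
  values at the vertices 4, 5, 3, 2; the value at 1 is absorbed into
  \<open>path_weight [c 2, c 1]\<close>.\<close>

lemma truncated_weight_5:
  "truncated_weight c 5 g = (\<Sum>y\<in>UNIV. \<Sum>z\<in>UNIV. \<Sum>v\<in>UNIV. \<Sum>u\<in>UNIV.
     path_weight [c 2, c 1] y u * fibre v (1 + c 3 * y) * fibre y (1 + c 4 * (u * v * z)) * g y z)"
proof -
  \<comment> \<open>The order of insertion fixes the nesting of the sums: vertex 4, listed last,
    becomes the outermost one.\<close>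
  have *: "{1..5::nat} = insert 1 (insert 2 (insert 3 (insert 5 (insert 4 {}))))"
    "{1..<5::nat} = {1, 2, 3, 4}" by auto
  have "truncated_weight c 5 g = (\<Sum>y\<in>UNIV. \<Sum>z\<in>UNIV. \<Sum>v\<in>UNIV. \<Sum>u\<in>UNIV. \<Sum>w\<in>UNIV.
     fibre u (1 + c 2 * y * w) * fibre w (1 + c 1 * u)
      * fibre v (1 + c 3 * y) * fibre y (1 + c 4 * (u * v * z)) * g y z)"
    unfolding truncated_weight_def *
    apply (subst sum_PiE_insert, simp)+
    apply (simp add: neighbors_E_graph)
    apply (intro sum.cong refl)
    apply (simp add: mult_ac)
    done
  moreover have "path_weight [c 2, c 1] y u
      = (\<Sum>w\<in>UNIV. fibre u (1 + c 2 * y * w) * fibre w (1 + c 1 * u))" for y u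
    by (simp only: path_weight.simps(2)[of "c 2"] path_weight_single)
  ultimately show ?thesis by (simp only: sum_distrib_right)
qed

text \<open>If \<open>x 4\<close> is nonzero, the three branches are independent given it. If it is
  zero, its equation makes the values at 2, 3 and 5 nonzero with a fixed product, so vertex 3 is
  determined and what remains are the paths beyond 2 and beyond 5.\<close>

lemma graph_weight_E_graph_sums:
  fixes c :: "nat \<Rightarrow> 'k::{field,finite}" and q :: real
  assumes q: "q = real CARD('k)" and n: "5 \<le> n" and c4: "c 4 \<noteq> 0"
  shows "graph_weight (E_graph n) c =
      (\<Sum>y\<in>UNIV - {0}. path_count [c 2, c 1] y * path_count [c 3] y * path_count (map c [5..<n+1]) y)
    + q * (\<Sum>u\<in>UNIV - {0}. path_count [c 1] u) * (\<Sum>z\<in>UNIV - {0}. path_count (map c [6..<n+1]) z)"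
proof -
  define g where "g = path_weight (map c [5..<n+1])"
  define p where "p = path_weight [c 2, c 1]"
  define F where "F y = (\<Sum>z\<in>UNIV. \<Sum>v\<in>UNIV. \<Sum>u\<in>UNIV.
     p y u * fibre v (1 + c 3 * y) * fibre y (1 + c 4 * (u * v * z)) * g y z)" for y
  have upt: "[5..<n+1] = 5 # [6..<n+1]" using n by (simp add: upt_conv_Cons)
  have F_nz: "F y = path_count [c 2, c 1] y * path_count [c 3] y * path_count (map c [5..<n+1]) y"
    if "y \<noteq> 0" for y
  proof -
    have "F y = (\<Sum>z\<in>UNIV. \<Sum>v\<in>UNIV. \<Sum>u\<in>UNIV. p y u * fibre v (1 + c 3 * y) * g y z)"
      using that by (simp add: F_def)
    also have "\<dots> = (\<Sum>u\<in>UNIV. p y u) * (\<Sum>v\<in>UNIV. fibre v (1 + c 3 * y)) * (\<Sum>z\<in>UNIV. g y z)"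
      by (simp add: sum_distrib_left sum_distrib_right)
    finally show ?thesis
      by (simp add: path_count_def p_def g_def del: path_weight.simps)
  qed
  \<comment> \<open>The equation at the zero vertex 4 singles out one \<open>v\<close>, nonzero as
    vertex 3 requires; \<open>q\<close> counts the free \<open>x' 4\<close>.\<close>
  have inner: "(\<Sum>v\<in>UNIV. fibre v 1 * fibre 0 (1 + c 4 * (u * v * z)))
      = (if u \<noteq> 0 \<and> z \<noteq> 0 then q else 0)" for u z
  proof (cases "u = 0 \<or> z = 0")
    case True
    then show ?thesis by (auto simp: fibre_zero)
  next
    case False
    have iff: "1 + c 4 * (u * v * z) = 0 \<longleftrightarrow> v = - 1 / (c 4 * u * z)" for v
      using False c4 by (simp add: field_simps eq_neg_iff_add_eq_0)
    have "fibre v 1 * fibre 0 (1 + c 4 * (u * v * z)) = (if v = - 1 / (c 4 * u * z) then q else 0)" for v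
      unfolding fibre_zero[of "1 + c 4 * (u * v * z)"] iff using False c4 by (simp add: q)
    then show ?thesis using False by simp
  qed
  have "F 0 = (\<Sum>z\<in>UNIV. \<Sum>u\<in>UNIV. p 0 u * g 0 z
      * (\<Sum>v\<in>UNIV. fibre v 1 * fibre 0 (1 + c 4 * (u * v * z))))"
    unfolding F_def sum_distrib_left by (subst sum.swap) (simp add: mult_ac)
  also have "\<dots> = (\<Sum>z\<in>UNIV - {0}. \<Sum>u\<in>UNIV - {0}. q * p 0 u * g 0 z)"
    unfolding inner sum_UNIV_split_zero by (simp add: mult_ac)
  also have "\<dots> = q * (\<Sum>u\<in>UNIV - {0}. p 0 u) * (\<Sum>z\<in>UNIV - {0}. g 0 z)"
    by (simp add: sum_distrib_left sum_distrib_right)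
  also have "(\<Sum>u\<in>UNIV - {0}. p 0 u) = (\<Sum>u\<in>UNIV - {0}. path_count [c 1] u)"
    unfolding p_def by (intro sum.cong refl path_weight_Cons_nonzero) auto
  also have "(\<Sum>z\<in>UNIV - {0}. g 0 z) = (\<Sum>z\<in>UNIV - {0}. path_count (map c [6..<n+1]) z)"
    unfolding g_def upt list.map by (intro sum.cong refl path_weight_Cons_nonzero) auto
  finally have F_0: "F 0 = q * (\<Sum>u\<in>UNIV - {0}. path_count [c 1] u)
      * (\<Sum>z\<in>UNIV - {0}. path_count (map c [6..<n+1]) z)" .
  have "graph_weight (E_graph n) c = (\<Sum>y\<in>UNIV. F y)"
    unfolding graph_weight_eq_truncated_weight_5[OF n] truncated_weight_5 F_def p_def g_def ..
  also have "\<dots> = (\<Sum>y\<in>UNIV - {0}. F y) + F 0" by (rule sum_UNIV_split_zero)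
  also have "(\<Sum>y\<in>UNIV - {0}. F y) = (\<Sum>y\<in>UNIV - {0}.
      path_count [c 2, c 1] y * path_count [c 3] y * path_count (map c [5..<n+1]) y)"
    by (intro sum.cong refl F_nz) auto
  finally show ?thesis unfolding F_0 .
qed


text \<open>The branch with vertices 2 and 1 has even length and gives the constant
  \<open>q^2 + 1\<close>. For even \<open>n\<close> the branch from 5 is constant too; for odd
  \<open>n\<close> it jumps, and the extra term appears when it jumps where the branch at 3
  does.\<close>

lemma graph_weight_E_graph:
  fixes c :: "nat \<Rightarrow> 'k::{field,finite}" and q :: real
  assumes q: "q = real CARD('k)" and n: "5 \<le> n" and c: "\<And>i. 1 \<le> i \<Longrightarrow> i \<le> n \<Longrightarrow> c i \<noteq> 0"
  shows "even n \<Longrightarrow> graph_weight (E_graph n) c = (q\<^sup>2 - q + 1) * ((q^(n-1) - 1) / (q - 1))"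
    and "odd n \<Longrightarrow> graph_weight (E_graph n) c =
      (q^(n+1) - q^n + q^(n-1) - q^((n+3) div 2) - q^((n-1) div 2) + q\<^sup>2 - q + 1) / (q - 1)
      + (if resonance (map c [3..<n+1]) = 1 then (q\<^sup>2 + 1) * q^((n-1) div 2) else 0)"
proof -
  have q2: "q \<ge> 2" unfolding q by (rule card_field_ge_2)
  note qsq = q_sq[OF q2]
  have c123: "c 1 \<noteq> 0" "c 2 \<noteq> 0" "c 3 \<noteq> 0" "c 4 \<noteq> 0" using c n by auto
  have nz: "0 \<notin> set (map c [5..<n+1])" "0 \<notin> set (map c [6..<n+1])" using c by (auto simp: image_iff)
  have one: "path_count [a] y = q - 1 + (if y = - 1 / a then q else 0)" if "a \<noteq> 0" "y \<noteq> 0" for a y :: 'k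
    using path_count_closed_form(2)[OF q, of "[a]" y 0] that qsq by (simp add: power2_eq_square)
  have two: "path_count [c 2, c 1] y = q\<^sup>2 + 1" if "y \<noteq> 0" for y
  proof -
    have "(q ^ 4 - 1) = (q\<^sup>2 + 1) * (q\<^sup>2 - 1)"
      by (simp add: algebra_simps flip: power_add)
    then show ?thesis
      using path_count_closed_form(1)[OF q, of "[c 2, c 1]" y 1] that c123 qsq by simp
  qed
  have sum_one: "(\<Sum>y\<in>UNIV - {0}. path_count [a] y) = q\<^sup>2 - q + 1" if "a \<noteq> 0" for a :: 'k
    using that by (simp add: one sum.distrib card_nonzero q[symmetric])
      (simp add: algebra_simps power2_eq_square)
  have start: "graph_weight (E_graph n) c =
      (\<Sum>y\<in>UNIV - {0}. (q\<^sup>2 + 1) * path_count [c 3] y * path_count (map c [5..<n+1]) y)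
      + q * (q\<^sup>2 - q + 1) * (\<Sum>z\<in>UNIV - {0}. path_count (map c [6..<n+1]) z)"
    unfolding graph_weight_E_graph_sums[of q n c, OF q n c123(4)] sum_one[OF c123(1)]
    by (simp add: two del: upt_Suc One_nat_def)
  {
    assume "even n"
    \<comment> \<open>Chosen so that the path from 6 to \<open>n\<close> has length
      \<open>2 * k + 1\<close>.\<close>
    then obtain k where k: "n = 2 * k + 6"
      using n by (auto elim!: evenE intro!: that[of "n div 2 - 3"])
    have "(\<Sum>y\<in>UNIV - {0}. (q\<^sup>2 + 1) * path_count [c 3] y * path_count (map c [5..<n+1]) y)
        = (\<Sum>y\<in>UNIV - {0}. (q\<^sup>2 + 1) * path_count [c 3] y * ((q^(2*k+4) - 1) / (q\<^sup>2 - 1)))"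
    proof (rule sum.cong)
      have exponent: "2 * (k+1) + 2 = 2 * k + 4" by simp
      fix y :: 'k assume "y \<in> UNIV - {0}"
      then show "(q\<^sup>2 + 1) * path_count [c 3] y * path_count (map c [5..<n+1]) y
          = (q\<^sup>2 + 1) * path_count [c 3] y * ((q^(2*k+4) - 1) / (q\<^sup>2 - 1))"
        using path_count_closed_form(1)[OF q nz(1), of y "k+1", unfolded exponent] k
        by (simp del: upt_Suc)
    qed simp
    also have "\<dots> = (q\<^sup>2 + 1) * (q\<^sup>2 - q + 1) * ((q^(2*k+4) - 1) / (q\<^sup>2 - 1))"
      unfolding sum_one[OF c123(3), symmetric] by (simp only: sum_distrib_left sum_distrib_right)
    finally have A: "(\<Sum>y\<in>UNIV - {0}. (q\<^sup>2 + 1) * path_count [c 3] y * path_count (map c [5..<n+1]) y)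
        = (q\<^sup>2 + 1) * (q\<^sup>2 - q + 1) * ((q^(2*k+4) - 1) / (q\<^sup>2 - 1))" .
    have "(\<Sum>z\<in>UNIV - {0}. path_count (map c [6..<n+1]) z)
        = (\<Sum>z\<in>UNIV - {0}. (q^(k+2) - 1) * (q^(k+1) - 1) / (q\<^sup>2 - 1)
            + (if z = resonance (map c [6..<n+1]) then q^(k+1) else 0))"
      using k by (intro sum.cong refl path_count_closed_form(2)[OF q nz(2)]) auto
    also have "\<dots> = (q - 1) * ((q^(k+2) - 1) * (q^(k+1) - 1) / (q\<^sup>2 - 1)) + q^(k+1)"
      using resonance_nonzero[OF nz(2)]
      by (simp add: sum.distrib card_nonzero q[symmetric] del: upt_Suc)
    finally have B: "(\<Sum>z\<in>UNIV - {0}. path_count (map c [6..<n+1]) z)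
        = (q - 1) * ((q^(k+2) - 1) * (q^(k+1) - 1) / (q\<^sup>2 - 1)) + q^(k+1)" .
    have exponent: "n - 1 = 2 * k + 5" using k by simp
    show "graph_weight (E_graph n) c = (q\<^sup>2 - q + 1) * ((q^(n-1) - 1) / (q - 1))"
      unfolding start A B exponent by (rule even_total[OF q2])
  next
    assume "odd n"
    \<comment> \<open>Chosen so that the path from 5 to \<open>n\<close> has length
      \<open>2 * k + 1\<close>.\<close>
    then obtain k where k: "n = 2 * k + 5"
      using n by (auto elim!: oddE intro!: that[of "n div 2 - 2"])
    define S where "S = (q^(k+2) - 1) * (q^(k+1) - 1) / (q\<^sup>2 - 1)"
    define r where "r = resonance (map c [5..<n+1])"
    have r: "r \<noteq> 0" unfolding r_def by (rule resonance_nonzero[OF nz(1)])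
    have upt: "[3..<n+1] = 3 # 4 # [5..<n+1]" using n by (simp add: upt_conv_Cons)
    \<comment> \<open>Coincidence of the jumps at \<open>- 1 / c 3\<close> and at \<open>r\<close>,
      read as a resonance of the whole path from 3 to \<open>n\<close>.\<close>
    have res: "resonance (map c [3..<n+1]) = 1 \<longleftrightarrow> r = - 1 / c 3"
      unfolding upt list.map resonance.simps r_def[symmetric] using r c123
      by (auto simp: field_simps)
    have "(\<Sum>y\<in>UNIV - {0}. (q\<^sup>2 + 1) * path_count [c 3] y * path_count (map c [5..<n+1]) y)
        = (\<Sum>y\<in>UNIV - {0}. (q\<^sup>2 + 1) * (q - 1 + (if y = - 1 / c 3 then q else 0))
            * (S + (if y = r then q^(k+1) else 0)))"
    proof (rule sum.cong)
      fix y :: 'k assume "y \<in> UNIV - {0}"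
      then show "(q\<^sup>2 + 1) * path_count [c 3] y * path_count (map c [5..<n+1]) y
          = (q\<^sup>2 + 1) * (q - 1 + (if y = - 1 / c 3 then q else 0))
            * (S + (if y = r then q^(k+1) else 0))"
        using path_count_closed_form(2)[OF q nz(1), of y k] k one[OF c123(3)]
        by (simp add: S_def r_def del: upt_Suc)
    qed simp
    \<comment> \<open>The product of the two jumps is attached to \<open>y = r\<close> with a test
      free of \<open>y\<close>, so each sum of a jump collapses to one point.\<close>
    also have "\<dots> = (\<Sum>y\<in>UNIV - {0}. (q\<^sup>2 + 1) * ((q - 1) * S + (if y = - 1 / c 3 then q * S else 0)
        + (if y = r then (q - 1) * q^(k+1) + (if r = - 1 / c 3 then q * q^(k+1) else 0) else 0)))"
      by (intro sum.cong refl) (auto simp: algebra_simps)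
    also have "\<dots> = (q\<^sup>2 + 1) * ((q\<^sup>2 - q + 1) * S + (q - 1) * q^(k+1))
        + (if r = - 1 / c 3 then (q\<^sup>2 + 1) * q^(k+2) else 0)"
      unfolding sum_distrib_left[symmetric] using r c123
      by (simp add: sum.distrib card_nonzero q[symmetric]) (simp add: algebra_simps power2_eq_square)
    finally have A: "(\<Sum>y\<in>UNIV - {0}. (q\<^sup>2 + 1) * path_count [c 3] y * path_count (map c [5..<n+1]) y)
        = (q\<^sup>2 + 1) * ((q\<^sup>2 - q + 1) * S + (q - 1) * q^(k+1))
        + (if r = - 1 / c 3 then (q\<^sup>2 + 1) * q^(k+2) else 0)" .
    have "(\<Sum>z\<in>UNIV - {0}. path_count (map c [6..<n+1]) z)
        = (\<Sum>z\<in>UNIV - {0::'k}. (q^(2*k+2) - 1) / (q\<^sup>2 - 1))"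
      using k by (intro sum.cong refl path_count_closed_form(1)[OF q nz(2)]) auto
    also have "\<dots> = (q - 1) * ((q^(2*k+2) - 1) / (q\<^sup>2 - 1))"
      by (simp add: card_nonzero q[symmetric])
    finally have B: "(\<Sum>z\<in>UNIV - {0}. path_count (map c [6..<n+1]) z)
      = (q - 1) * ((q^(2*k+2) - 1) / (q\<^sup>2 - 1))" .
    have exps: "q^(n+1) = q^(2*k+6)" "q^n = q^(2*k+5)" "q^(n-1) = q^(2*k+4)"
      "q^((n+3) div 2) = q^(k+4)" "q^((n-1) div 2) = q^(k+2)"
      using k by (auto intro!: arg_cong[of _ _ "power q"])
    show "graph_weight (E_graph n) c =
      (q^(n+1) - q^n + q^(n-1) - q^((n+3) div 2) - q^((n-1) div 2) + q\<^sup>2 - q + 1) / (q - 1)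
      + (if resonance (map c [3..<n+1]) = 1 then (q\<^sup>2 + 1) * q^((n-1) div 2) else 0)"
      unfolding start A B res exps odd_total[OF q2, of k, symmetric] S_def by simp
  }
qed

text \<open>Going back from \<open>n\<close> in steps of two, each step inverts and changes sign, so
  the resonance is a sign times \<open>a\<close> or \<open>1 / a\<close>. Either one equals 1
  exactly when \<open>a\<close> is that sign.\<close>

lemma resonance_one_parameter:
  fixes a :: "'k::field"
  assumes n: "odd n" and u: "odd u" "3 \<le> u" "u \<le> n" and a: "a \<noteq> 0"
  shows "resonance (map (\<lambda>i. if i = u then a else 1) [3..<n+1]) = 1 \<longleftrightarrow> a = (-1) ^ ((n-1) div 2)"
proof -
  define c where "c = (\<lambda>i. if i = u then a else 1)"
  \<comment> \<open>Before \<open>u\<close> is reached only the sign has accumulated; afterwards it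
    suffices to know the value up to inverting \<open>a\<close>.\<close>
  have *: "resonance (map c [n - 2*j..<n+1]) \<in>
      (if u < n - 2*j then {(-1)^(j+1)} else {(-1)^(j+1) * a, (-1)^(j+1) / a})"
    if "2 * j + 3 \<le> n" for j
    using that
  proof (induction j)
    case 0
    then show ?case using u by (auto simp: c_def)
  next
    case (Suc j)
    define m where "m = n - 2 * Suc j"
    have m: "n - 2 * j = Suc (Suc m)" using Suc.prems m_def by simp
    have "odd m" using n Suc.prems m_def by simp
    \<comment> \<open>The vertices skipped by the resonance are even, so the parameter is never
      among them.\<close>
    then have "u \<noteq> Suc m" using u by auto
    have upt: "[m..<n+1] = m # Suc m # [Suc (Suc m)..<n+1]"
      using m by (simp add: upt_conv_Cons)
    have step: "resonance (map c [m..<n+1]) = - 1 / (c m * resonance (map c [n - 2*j..<n+1]))"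
      unfolding upt m by simp
    have e: "(-1::'k)^j = 1 \<or> (-1::'k)^j = -1" by (cases "even j") auto
    have "Suc (Suc m) \<le> n" using m by simp
    then show ?case unfolding m_def[symmetric] step
      using Suc.IH Suc.prems a e \<open>u \<noteq> Suc m\<close> unfolding m
      by (auto simp: c_def split: if_splits)
  qed
  obtain j where j: "n = 2 * j + 3"
    using n u by (auto elim!: oddE intro!: that[of "n div 2 - 1"])
  define s where "s = (-1::'k) ^ (j+1)"
  have "s * s = 1" unfolding s_def by (simp flip: power_add)
  then have "s * a = 1 \<longleftrightarrow> a = s" by (metis mult.assoc mult.left_neutral mult.right_neutral)
  moreover have "s / a = 1 \<longleftrightarrow> a = s" using a by auto
  moreover have "resonance (map c [3..<n+1]) = s * a \<or> resonance (map c [3..<n+1]) = s / a"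
    using *[of j] j u unfolding s_def by (simp del: upt_Suc power_Suc)
  moreover have "(n - 1) div 2 = j + 1" using j by simp
  ultimately show ?thesis unfolding c_def[symmetric] by (metis s_def)
qed

section \<open>Matchings and vertex covers\<close>

text \<open>Dominoes are disjoint and each meets the cover, so \<open>card M\<close> is at most the
  sum of all \<open>card (S \<inter> e)\<close>, which is at most \<open>card S\<close>. The other
  two claims read off the case of equality.\<close>

lemma matching_vertex_cover:
  assumes fin: "finite (verts T)" and sub: "\<And>e. e \<in> edges T \<Longrightarrow> e \<subseteq> verts T"
    and M: "matching T M" and S: "vertex_cover T S"
  shows card_matching_le_cover: "card M \<le> card S"
    and tight_cover_subset: "card S \<le> card M \<Longrightarrow> S \<subseteq> \<Union>M"
    and tight_cover_meets_once: "card S \<le> card M \<Longrightarrow> e \<in> M \<Longrightarrow> card (S \<inter> e) = 1"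
proof -
  have ME: "M \<subseteq> edges T" using M by (simp add: matching_def)
  have finM: "finite M"
    using ME sub fin by (intro finite_subset[of M "Pow (verts T)"]) auto
  have finS: "finite S" using S fin finite_subset by (auto simp: vertex_cover_def)
  have disj: "d \<inter> e = {}" if "d \<in> M" "e \<in> M" "d \<noteq> e" for d e
    using that M sub ME unfolding matching_def by blast
  have eq: "card (\<Union>e\<in>M. S \<inter> e) = (\<Sum>e\<in>M. card (S \<inter> e))"
    using finM finS disj by (intro card_UN_disjoint) auto
  have ge: "1 \<le> card (S \<inter> e)" if "e \<in> M" for e
    using that S ME finS by (auto simp: vertex_cover_def Suc_le_eq card_gt_0_iff)
  have 1: "card M \<le> (\<Sum>e\<in>M. card (S \<inter> e))"
    using sum_mono[of M "\<lambda>_. 1" "\<lambda>e. card (S \<inter> e)"] ge by simp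
  have sub': "(\<Union>e\<in>M. S \<inter> e) \<subseteq> S" by auto
  have 2: "card (\<Union>e\<in>M. S \<inter> e) \<le> card S" using finS sub' by (rule card_mono)
  show "card M \<le> card S" using 1 2 eq by simp
  assume tight: "card S \<le> card M"
  have "(\<Union>e\<in>M. S \<inter> e) = S"
    using finS sub' 1 2 eq tight by (intro card_subset_eq) auto
  then show "S \<subseteq> \<Union>M" by auto
  assume "e \<in> M"
  \<comment> \<open>The terms on the right are at least 1 and the totals agree, so each equals
    1.\<close>
  moreover have "(\<Sum>e\<in>M. 1) = (\<Sum>e\<in>M. card (S \<inter> e))" using 1 2 eq tight by simp
  ultimately show "card (S \<inter> e) = 1"
    using sum_mono_inv[of "\<lambda>_. 1" M "\<lambda>e. card (S \<inter> e)" e] ge finM by simp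
qed

section \<open>Maximum matchings and minimum covers of \<open>E_graph n\<close>\<close>

lemma edges_E_graph_subset: "4 \<le> n \<Longrightarrow> e \<in> edges (E_graph n) \<Longrightarrow> e \<subseteq> {1..n}"
  unfolding E_graph_def snd_conv Un_iff insert_iff mem_Collect_eq by (elim disjE exE conjE) auto

lemma card_edge_E_graph: "e \<in> edges (E_graph n) \<Longrightarrow> card e = 2"
  unfolding E_graph_def snd_conv Un_iff insert_iff mem_Collect_eq by (elim disjE exE conjE) auto

lemma edge_E_graphE:
  assumes "e \<in> edges (E_graph n)"
  obtains i j where "e = {i, j}" "{i, j} \<in> edges (E_graph n)" "i < j"
proof -
  obtain x y where xy: "e = {x, y}" "x \<noteq> y"
    using card_edge_E_graph[OF assms] by (auto simp: card_2_iff)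
  then show ?thesis
    using that[of x y] that[of y x] assms by (cases "x < y") (simp_all add: insert_commute)
qed

text \<open>An explicit maximum matching: perfect for even \<open>n\<close>, missing only the end
  vertex \<open>n\<close> for odd \<open>n\<close>.\<close>

definition E_dominoes :: "nat \<Rightarrow> nat set set" where
  "E_dominoes n = (\<lambda>j. {2 * j - 1, 2 * j}) ` {1..n div 2}"

lemma card_E_dominoes: "card (E_dominoes n) = n div 2"
proof -
  have "inj_on (\<lambda>j::nat. {2 * j - 1, 2 * j}) {1..n div 2}"
    by (rule inj_onI) (simp only: doubleton_eq_iff atLeastAtMost_iff, presburger)
  then show ?thesis by (simp add: E_dominoes_def card_image)
qed

lemma matching_E_dominoes:
  assumes "4 \<le> n"
  shows "matching (E_graph n) (E_dominoes n)"
  unfolding matching_def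
proof (intro conjI subsetI ballI impI)
  fix e assume "e \<in> E_dominoes n"
  then obtain j where j: "e = {2 * j - 1, 2 * j}" "1 \<le> j" "j \<le> n div 2"
    unfolding E_dominoes_def by auto
  show "e \<in> edges (E_graph n)" unfolding j(1) E_graph_edge_iff using j(2,3) by presburger
next
  fix i d e assume de: "d \<in> E_dominoes n" "e \<in> E_dominoes n" and "i \<in> d" "i \<in> e"
  from de obtain j k where j: "d = {2 * j - 1, 2 * j}" "1 \<le> j" and k: "e = {2 * k - 1, 2 * k}" "1 \<le> k"
    unfolding E_dominoes_def by auto
  have "j = k" using \<open>i \<in> d\<close> \<open>i \<in> e\<close> j k unfolding j(1) k(1) insert_iff empty_iff by presburger
  then show "d = e" using j k by simp
qed

lemma card_Union_matching_E_graph: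
  assumes n: "4 \<le> n" and M: "matching (E_graph n) M"
  shows "card (\<Union>M) = 2 * card M" and "\<Union>M \<subseteq> {1..n}"
proof -
  have ME: "M \<subseteq> edges (E_graph n)" using M by (simp add: matching_def)
  show sub: "\<Union>M \<subseteq> {1..n}" using ME edges_E_graph_subset[OF n] by blast
  have "card (\<Union>M) = (\<Sum>e\<in>M. card e)"
  proof (rule card_Union_disjoint)
    show "pairwise disjnt M"
      using M sub unfolding matching_def pairwise_def disjnt_def verts_E_graph by blast
    show "\<And>e. e \<in> M \<Longrightarrow> finite e" using sub finite_subset[of _ "{1..n}"] by blast
  qed
  also have "\<dots> = (\<Sum>e\<in>M. 2)" using ME card_edge_E_graph by (intro sum.cong) auto
  finally show "card (\<Union>M) = 2 * card M" by simp
qed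

lemma maximum_matching_E_graph:
  assumes n: "4 \<le> n" and M: "maximum_matching (E_graph n) M"
  shows "card M = n div 2" and "card (uncovered (E_graph n) M) = n mod 2"
proof -
  have mM: "matching (E_graph n) M" using M by (simp add: maximum_matching_def)
  note U = card_Union_matching_E_graph[OF n mM]
  have "n div 2 \<le> card M"
    using M matching_E_dominoes[OF n] card_E_dominoes[of n] by (metis maximum_matching_def)
  moreover have "2 * card M \<le> n" using card_mono[OF _ U(2)] U(1) by simp
  ultimately show c: "card M = n div 2" by linarith
  have "card (uncovered (E_graph n) M) = n - 2 * (n div 2)"
    unfolding uncovered_def verts_E_graph using U c
    by (subst card_Diff_subset) (auto intro: finite_subset)
  then show "card (uncovered (E_graph n) M) = n mod 2" by (simp add: minus_mult_div_eq_mod)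
qed

text \<open>Every cover has at least as many vertices as \<open>E_dominoes n\<close> has dominoes,
  so size \<open>n div 2\<close> certifies minimality.\<close>

lemma minimum_vertex_cover_E_graphI:
  assumes n: "4 \<le> n" and S: "vertex_cover (E_graph n) S" and card: "card S \<le> n div 2"
  shows "minimum_vertex_cover (E_graph n) S"
  unfolding minimum_vertex_cover_def
proof (intro conjI allI impI S)
  fix S' assume "vertex_cover (E_graph n) S'"
  then have "card (E_dominoes n) \<le> card S'"
    using edges_E_graph_subset[OF n] matching_E_dominoes[OF n]
    by (intro card_matching_le_cover[of "E_graph n"]) auto
  then show "card S \<le> card S'" using card card_E_dominoes[of n] by simp
qed

lemma vertex_cover_E_graphI:
  assumes "S \<subseteq> {1..n}" "\<And>i j. {i, j} \<in> edges (E_graph n) \<Longrightarrow> i < j \<Longrightarrow> i \<in> S \<or> j \<in> S"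
  shows "vertex_cover (E_graph n) S"
  unfolding vertex_cover_def
proof (intro conjI ballI)
  fix e assume "e \<in> edges (E_graph n)"
  then obtain i j where "e = {i, j}" "{i, j} \<in> edges (E_graph n)" "i < j" by (rule edge_E_graphE)
  then show "S \<inter> e \<noteq> {}" using assms(2)[of i j] by auto
qed (use assms(1) in simp)

lemma card_evens: "card {i \<in> {1..n::nat}. even i} = n div 2"
proof -
  have "{i \<in> {1..n}. even i} = (\<lambda>j. 2 * j) ` {1..n div 2}"
    by (auto elim!: evenE)
  then show ?thesis by (simp add: card_image inj_on_def)
qed

text \<open>Vertex 2 may be exchanged for 1, since 4 still covers the edge between 2 and 4.\<close>

lemma even_cover_E_graph:
  assumes n: "4 \<le> n"
  shows "minimum_vertex_cover (E_graph n) {i \<in> {1..n}. even i}" (is "minimum_vertex_cover _ ?A")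
    and "minimum_vertex_cover (E_graph n) (insert 1 ({i \<in> {1..n}. even i} - {2}))"
      (is "minimum_vertex_cover _ ?B")
proof -
  have edge: "(i \<in> ?A \<or> j \<in> ?A) \<and> (i \<in> ?B \<or> j \<in> ?B)"
    if "{i, j} \<in> edges (E_graph n)" "i < j" for i j
    using that n
    unfolding E_graph_edge_iff mem_Collect_eq insert_iff Diff_iff atLeastAtMost_iff empty_iff
    by presburger
  have "card ?B \<le> n div 2"
    using n card_evens[of n] by (simp add: card_insert_if card_Diff_singleton)
  moreover have "vertex_cover (E_graph n) ?B"
    using edge n by (intro vertex_cover_E_graphI) auto
  ultimately show "minimum_vertex_cover (E_graph n) ?B"
    using n by (intro minimum_vertex_cover_E_graphI)
  have "vertex_cover (E_graph n) ?A"
    using edge by (intro vertex_cover_E_graphI) auto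
  then show "minimum_vertex_cover (E_graph n) ?A"
    using n card_evens[of n] by (intro minimum_vertex_cover_E_graphI) auto
qed

lemma card_minimum_vertex_cover_E_graph:
  assumes "4 \<le> n" "minimum_vertex_cover (E_graph n) S"
  shows "vertex_cover (E_graph n) S" and "card S \<le> n div 2"
  using assms even_cover_E_graph(1)[OF assms(1)]
  unfolding minimum_vertex_cover_def card_evens[of n, symmetric] by blast+

text \<open>Every minimum cover has the size of \<open>M\<close>, so the case of equality puts it
  inside the covered vertices. The two explicit covers then exclude the even vertices and 1.\<close>

lemma uncovered_E_graph_red:
  assumes n: "4 \<le> n" and M: "maximum_matching (E_graph n) M"
    and u: "u \<in> uncovered (E_graph n) M"
  shows "u \<in> red (E_graph n)" and "odd u" and "3 \<le> u" and "u \<le> n"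
proof -
  have u': "u \<in> {1..n}" "u \<notin> \<Union>M" using u by (auto simp: uncovered_def)
  have notin: "u \<notin> S" if "minimum_vertex_cover (E_graph n) S" for S
  proof -
    have "S \<subseteq> \<Union>M"
      using edges_E_graph_subset[OF n] M card_minimum_vertex_cover_E_graph[OF n that]
        maximum_matching_E_graph(1)[OF n M]
      by (intro tight_cover_subset[of "E_graph n"]) (auto simp: maximum_matching_def)
    then show ?thesis using u' by blast
  qed
  show "u \<in> red (E_graph n)" using notin u' by (auto simp: red_def)
  show "odd u" using notin[OF even_cover_E_graph(1)[OF n]] u' by auto
  moreover have "u \<noteq> 1" using notin[OF even_cover_E_graph(2)[OF n]] u' by auto
  ultimately show "3 \<le> u" using u' by (cases "u = 2") auto
  show "u \<le> n" using u' by simp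
qed

text \<open>Forced from the end inwards: \<open>n\<close> is missed by \<open>E_dominoes n\<close>
  and so lies outside the cover, its neighbour must lie inside, the partner of that one outside, and
  so on down to 3.\<close>

lemma minimum_vertex_cover_E_graph_odd:
  assumes n: "5 \<le> n" "odd n" and S: "minimum_vertex_cover (E_graph n) S"
  shows "3 \<le> i \<Longrightarrow> i \<le> n \<Longrightarrow> i \<in> S \<longleftrightarrow> even i"
proof -
  have n4: "4 \<le> n" using n by simp
  note S' = card_minimum_vertex_cover_E_graph[OF n4 S]
  have cover: "i \<in> S \<or> j \<in> S" if "{i, j} \<in> edges (E_graph n)" for i j
  proof -
    have "S \<inter> {i, j} \<noteq> {}" using S'(1) that unfolding vertex_cover_def by (elim conjE) (erule bspec)
    then show ?thesis by simp
  qed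
  have sub: "S \<subseteq> \<Union>(E_dominoes n)"
    using edges_E_graph_subset[OF n4] matching_E_dominoes[OF n4] S' card_E_dominoes[of n]
    by (intro tight_cover_subset[of "E_graph n"]) auto
  have once: "card (S \<inter> {2 * j - 1, 2 * j}) = 1" if "1 \<le> j" "j \<le> n div 2" for j
    using edges_E_graph_subset[OF n4] matching_E_dominoes[OF n4] S' card_E_dominoes[of n] that
    by (intro tight_cover_meets_once[of "E_graph n" "E_dominoes n"]) (auto simp: E_dominoes_def)
  have odd: "n - 2 * j \<notin> S" if "2 * j + 3 \<le> n" for j
    using that
  proof (induction j)
    case 0
    have "n \<notin> {2 * j - 1, 2 * j}" if "j \<in> {1..n div 2}" for j
      using that n(2) unfolding insert_iff empty_iff atLeastAtMost_iff by presburger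
    then have "n \<notin> \<Union>(E_dominoes n)" unfolding E_dominoes_def by blast
    then show ?case using sub by auto
  next
    case (Suc j)
    \<comment> \<open>The index of the domino just before the vertex
      \<open>n - 2 * j\<close>.\<close>
    define k where "k = (n - 2 * j - 1) div 2"
    have k: "n - 2 * j = 2 * k + 1" "n - 2 * Suc j = 2 * k - 1" "2 \<le> k" "k \<le> n div 2"
      using n Suc.prems unfolding k_def by presburger+
    have "{2 * k, 2 * k + 1} \<in> edges (E_graph n)"
      unfolding E_graph_edge_iff using k by presburger
    then have "2 * k \<in> S" using cover Suc k by auto
    moreover have "2 * k - 1 \<noteq> 2 * k" using k by simp
    ultimately show ?case using once[of k] k by (cases "2 * k - 1 \<in> S") auto
  qed
  have odd': "i \<notin> S" if "odd i" "3 \<le> i" "i \<le> n" for i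
  proof -
    have "2 * ((n - i) div 2) + 3 \<le> n" "n - 2 * ((n - i) div 2) = i" using that n by presburger+
    then show ?thesis using odd[of "(n - i) div 2"] by simp
  qed
  assume i: "3 \<le> i" "i \<le> n"
  show "i \<in> S \<longleftrightarrow> even i"
  proof (cases "even i")
    case True
    have "{i, i + 1} \<in> edges (E_graph n)"
      unfolding E_graph_edge_iff using i n True by presburger
    moreover have "i + 1 \<notin> S" using i n True by (intro odd') presburger+
    ultimately show ?thesis using True cover by blast
  qed (use odd' i in auto)
qed

section \<open>The red-green component\<close>

lemma red_E_graph: "5 \<le> n \<Longrightarrow> odd n \<Longrightarrow> odd i \<Longrightarrow> 3 \<le> i \<Longrightarrow> i \<le> n \<Longrightarrow> i \<in> red (E_graph n)"
  using minimum_vertex_cover_E_graph_odd[of n _ i] by (simp add: red_def)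

text \<open>Admissibility is tested at every green vertex, hence the full description. The two
  explicit covers meet exactly in these vertices.\<close>

lemma green_E_graph_iff:
  assumes "5 \<le> n" "odd n"
  shows "i \<in> green (E_graph n) \<longleftrightarrow> even i \<and> 4 \<le> i \<and> i \<le> n"
proof
  assume i: "i \<in> green (E_graph n)"
  then have "i \<in> {i \<in> {1..n}. even i}" "i \<in> insert 1 ({i \<in> {1..n}. even i} - {2})"
    using even_cover_E_graph[of n] assms unfolding green_def by auto
  then show "even i \<and> 4 \<le> i \<and> i \<le> n"
    unfolding mem_Collect_eq insert_iff Diff_iff atLeastAtMost_iff empty_iff by presburger
next
  assume "even i \<and> 4 \<le> i \<and> i \<le> n"
  then show "i \<in> green (E_graph n)"
    using minimum_vertex_cover_E_graph_odd[OF assms, of _ i] by (simp add: green_def)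
qed

text \<open>From 3 to \<open>n\<close> consecutive vertices are adjacent and alternate between red
  and green; by symmetry \<open>u\<close> reaches 3 and from there all the others.\<close>

lemma red_green_component_E_graph:
  assumes n: "5 \<le> n" "odd n" and u: "3 \<le> u" "u \<le> n"
  shows "{3..n} \<subseteq> (red_green_adjacency (E_graph n))\<^sup>* `` {u}"
proof -
  let ?R = "red_green_adjacency (E_graph n)"
  have step: "(i, i + 1) \<in> ?R" if "3 \<le> i" "i < n" for i
  proof -
    have edge: "{i, i + 1} \<in> edges (E_graph n)"
      unfolding E_graph_edge_iff using that by presburger
    show ?thesis
    proof (cases "even i")
      case True
      have "4 \<le> i" "odd (i + 1)" "3 \<le> i + 1" "i + 1 \<le> n" using that True by presburger+
      then show ?thesis using edge True that red_E_graph[OF n, of "i + 1"] green_E_graph_iff[OF n, of i]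
        unfolding red_green_adjacency_def mem_Collect_eq prod.case by simp
    next
      case False
      have "even (i + 1)" "4 \<le> i + 1" "i + 1 \<le> n" using that False by presburger+
      then show ?thesis using edge False that red_E_graph[OF n, of i] green_E_graph_iff[OF n, of "i + 1"]
        unfolding red_green_adjacency_def mem_Collect_eq prod.case by simp
    qed
  qed
  have from3: "(3, i) \<in> ?R\<^sup>*" if "3 \<le> i" "i \<le> n" for i
    using that
  proof (induction i rule: dec_induct)
    case (step i)
    then show ?case using assms \<open>\<And>i. 3 \<le> i \<Longrightarrow> i < n \<Longrightarrow> (i, i + 1) \<in> ?R\<close>[of i]
      by (simp add: rtrancl.rtrancl_into_rtrancl)
  qed simp
  have "sym ?R" by (auto simp: sym_def red_green_adjacency_def insert_commute)
  then have "(u, 3) \<in> ?R\<^sup>*" using from3[OF u] by (metis sym_rtrancl symD)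
  then show ?thesis using from3 by (auto intro: rtrancl_trans)
qed

text \<open>The odd vertices from \<open>3\<close> on form the only admissible set, and the product over it reduces
  to the parameter of the uncovered vertex.\<close>

lemma generic_parameters_E_graph:
  fixes \<alpha> :: "nat \<Rightarrow> 'k::field"
  assumes n: "5 \<le> n" "odd n" and M: "maximum_matching (E_graph n) M"
    and u: "uncovered (E_graph n) M = {u}"
    and gen: "generic_parameters (E_graph n) (\<lambda>_. Generic) M \<alpha>"
  shows "\<alpha> u \<noteq> 0" and "\<alpha> u \<noteq> (-1) ^ ((n - 1) div 2)"
proof -
  define C where "C = (red_green_adjacency (E_graph n))\<^sup>* `` {u}"
  define S where "S = {i \<in> {3..n}. odd i}"
  \<comment> \<open>Signs alternate along the odd vertices and are normalised to be 1 at
    \<open>u\<close>, so the product is the parameter itself and not its inverse.\<close>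
  define \<epsilon> :: "nat \<Rightarrow> int" where "\<epsilon> i = (if i mod 4 = u mod 4 then 1 else - 1)" for i
  have "4 \<le> n" "u \<in> uncovered (E_graph n) M" using n u by auto
  note ured = uncovered_E_graph_red[OF this(1) M this(2)]
  have C: "C \<in> red_green_components (E_graph n)"
    unfolding red_green_components_def C_def using ured(1) by blast
  have C3: "{3..n} \<subseteq> C" unfolding C_def by (rule red_green_component_E_graph[OF n ured(3,4)])
  \<comment> \<open>At \<open>g = 4\<close> the third neighbour 2 is even, and \<open>g + 1\<close>
    never exceeds \<open>n\<close> because \<open>n\<close> is odd.\<close>
  have nb: "neighbors (E_graph n) g \<inter> S = {g - 1, g + 1}" if "g \<in> green (E_graph n)" for g
  proof -
    have g: "even g" "4 \<le> g" "g \<le> n" using that green_E_graph_iff[OF n] by auto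
    show ?thesis unfolding neighbors_def S_def E_graph_edge_iff verts_E_graph using g n(2)
      by (simp only: set_eq_iff mem_Collect_eq insert_iff empty_iff atLeastAtMost_iff Int_iff)
        presburger
  qed
  have "S \<noteq> {}" using ured by (auto simp: S_def)
  moreover have "S \<subseteq> C \<inter> red (E_graph n)" using C3 red_E_graph[OF n] by (auto simp: S_def)
  ultimately have adm: "admissible (E_graph n) C S"
    unfolding admissible_def by (simp add: nb card_insert_if)
  have alt: "alternating_signs (E_graph n) C S \<epsilon>"
    unfolding alternating_signs_def
  proof (intro conjI ballI impI)
    fix i j assume ij: "i \<in> S" "j \<in> S" "i \<noteq> j"
      and "\<exists>g\<in>C \<inter> green (E_graph n). g \<in> neighbors (E_graph n) i \<inter> neighbors (E_graph n) j"
    then obtain g where g: "g \<in> green (E_graph n)" "g \<in> neighbors (E_graph n) i" "g \<in> neighbors (E_graph n) j"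
      by blast
    then have "i \<in> neighbors (E_graph n) g" "j \<in> neighbors (E_graph n) g"
      using ij by (auto simp: neighbors_def S_def insert_commute)
    then have "i \<in> {g - 1, g + 1}" "j \<in> {g - 1, g + 1}" using ij nb[OF g(1)] by blast+
    then have "j = i + 2 \<or> i = j + 2"
      using \<open>i \<noteq> j\<close> g green_E_graph_iff[OF n] by auto
    moreover have "(k + 2) mod 4 = u mod 4 \<longleftrightarrow> k mod 4 \<noteq> u mod 4" if "odd k" for k
    proof -
      have "k mod 4 = 1 \<or> k mod 4 = 3" "u mod 4 = 1 \<or> u mod 4 = 3"
        using that ured(2) by presburger+
      moreover have "(k + 2) mod 4 = (k mod 4 + 2) mod 4" by (simp add: mod_simps)
      ultimately show ?thesis by (elim disjE) (simp_all del: add_2_eq_Suc')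
    qed
    ultimately have "i mod 4 = u mod 4 \<longleftrightarrow> j mod 4 \<noteq> u mod 4"
      using ij by (auto simp: S_def)
    then show "\<epsilon> i = - \<epsilon> j" by (simp add: \<epsilon>_def)
  qed (simp add: \<epsilon>_def)
  have "S = (\<lambda>j. 2 * j + 1) ` {1..(n - 1) div 2}"
    using n by (auto simp: S_def elim!: oddE)
  then have card: "card S = (n - 1) div 2" by (simp add: card_image inj_on_def)
  have "u \<in> S" "finite S" using ured by (auto simp: S_def)
  have "(\<Prod>i\<in>S. (if i \<in> uncovered (E_graph n) M then \<alpha> i else 1) powi \<epsilon> i)
      = (\<Prod>i\<in>S. if i = u then \<alpha> u else 1)"
    by (intro prod.cong refl) (simp add: u \<epsilon>_def)
  also have "\<dots> = \<alpha> u" using \<open>u \<in> S\<close> \<open>finite S\<close> by simp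
  finally have "(\<Prod>i\<in>S. (if i \<in> uncovered (E_graph n) M then \<alpha> i else 1) powi \<epsilon> i) = \<alpha> u" .
  moreover have "(\<forall>u\<in>C \<inter> uncovered (E_graph n) M. \<alpha> u \<noteq> 0) \<and>
        (\<forall>S \<epsilon>. admissible (E_graph n) C S \<longrightarrow> alternating_signs (E_graph n) C S \<epsilon> \<longrightarrow>
           (\<Prod>i\<in>S. (if i \<in> uncovered (E_graph n) M then \<alpha> i else 1) powi \<epsilon> i) \<noteq> (-1) ^ card S)"
    using gen C unfolding generic_parameters_def by simp
  ultimately show "\<alpha> u \<noteq> 0" "\<alpha> u \<noteq> (-1) ^ ((n - 1) div 2)"
    using adm alt card C3 ured u by auto
qed

section \<open>Point counts\<close>

theorem proposition4p12:
  fixes n :: nat and M :: "nat set set" and \<phi> :: "nat set \<Rightarrow> component_kind"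
    and \<alpha> :: "nat \<Rightarrow> 'k::{field,finite}" and q :: real
  assumes "n \<ge> 5"
    and "maximum_matching (E_graph n) M"
    and "q = real CARD('k)"
  shows "(even n \<longrightarrow>
            real (card (points (E_graph n) \<phi> M \<alpha>))
              = (q^2 - q + 1) * ((q^(n-1) - 1) / (q - 1)))
       \<and> (odd n \<longrightarrow>
            real (card (points (E_graph n) (\<lambda>_. Versal) M \<alpha>))
              = (q^2 - q + 1) * (1 + q^(n-1)))
       \<and> (odd n \<longrightarrow> generic_parameters (E_graph n) (\<lambda>_. Generic) M \<alpha> \<longrightarrow>
            real (card (points (E_graph n) (\<lambda>_. Generic) M \<alpha>))
              = (q^(n+1) - q^n + q^(n-1) - q^((n+3) div 2) - q^((n-1) div 2) + q^2 - q + 1)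
                  / (q - 1))"
proof (intro conjI impI)
  note n = assms(1) and M = assms(2) and q = assms(3)
  have q2: "q \<ge> 2" unfolding q by (rule card_field_ge_2)
  have n4: "4 \<le> n" using n by simp
  have points: "real (card (points (E_graph n) \<psi> M \<alpha>)) =
      (\<Sum>\<beta>\<in>versal_vertices (E_graph n) \<psi> M \<rightarrow>\<^sub>E (UNIV - {0}).
        graph_weight (E_graph n) (coefficient (E_graph n) \<psi> M \<alpha> \<beta>))" for \<psi>
    by (rule card_points) simp
  {
    assume "even n"
    \<comment> \<open>Every vertex is covered, so all coefficients are 1 and the sum over \<beta>
      has a single term.\<close>
    then have un: "uncovered (E_graph n) M = {}"
      using maximum_matching_E_graph(2)[OF n4 M] by (simp add: uncovered_def)
    then have "versal_vertices (E_graph n) \<phi> M = {}"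
      "coefficient (E_graph n) \<phi> M \<alpha> \<beta> = (\<lambda>_. 1)" for \<beta>
      by (auto simp: versal_vertices_def coefficient_def)
    then show "real (card (points (E_graph n) \<phi> M \<alpha>)) = (q^2 - q + 1) * ((q^(n-1) - 1) / (q - 1))"
      unfolding points using graph_weight_E_graph(1)[OF q n, of "\<lambda>_. 1"] \<open>even n\<close> by simp
  next
    assume odd: "odd n"
    define m where "m = (n - 1) div 2"
    define G where "G = (q^(n+1) - q^n + q^(n-1) - q^((n+3) div 2) - q^((n-1) div 2) + q^2 - q + 1)
        / (q - 1)"
    have "card (uncovered (E_graph n) M) = 1"
      using maximum_matching_E_graph(2)[OF n4 M] odd by (simp add: odd_iff_mod_2_eq_one)
    then obtain u where u: "uncovered (E_graph n) M = {u}" by (rule card_1_singletonE)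
    then have "u \<in> uncovered (E_graph n) M" by simp
    note ured = uncovered_E_graph_red[OF n4 M this]
    \<comment> \<open>As a function of the parameter the count is constant except at one value,
      where it jumps.\<close>
    have weight: "graph_weight (E_graph n) (\<lambda>i. if i = u then a else 1)
        = G + (if a = (-1) ^ m then (q^2 + 1) * q^m else 0)" if "a \<noteq> 0" for a :: 'k
      using graph_weight_E_graph(2)[OF q n, of "\<lambda>i. if i = u then a else 1"] odd that
      unfolding resonance_one_parameter[OF odd ured(2-4) that] G_def m_def by simp
    {
      have "u \<in> (red_green_adjacency (E_graph n))\<^sup>* `` {u}" by simp
      then have vv: "versal_vertices (E_graph n) (\<lambda>_. Versal) M = {u}"
        using u ured(1) unfolding versal_vertices_def red_green_components_def by blast
      have "coefficient (E_graph n) (\<lambda>_. Versal) M \<alpha> \<beta> = (\<lambda>i. if i = u then \<beta> u else 1)" for \<beta>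
        unfolding coefficient_def u vv by auto
      then have "real (card (points (E_graph n) (\<lambda>_. Versal) M \<alpha>)) =
          (\<Sum>a\<in>UNIV - {0::'k}. graph_weight (E_graph n) (\<lambda>i. if i = u then a else 1))"
        unfolding points vv by (simp add: sum_PiE_insert cong: if_cong)
      also have "\<dots> = (\<Sum>a\<in>UNIV - {0::'k}. G + (if a = (-1) ^ m then (q^2 + 1) * q^m else 0))"
        by (intro sum.cong refl weight) simp
      \<comment> \<open>The exceptional parameter is nonzero, hence met once among the
        \<open>q - 1\<close> invertible values.\<close>
      also have "\<dots> = (q - 1) * G + (q^2 + 1) * q^m"
        by (simp add: sum.distrib card_nonzero q[symmetric])
      also have "(q - 1) * G = q^(2*m+2) - q^(2*m+1) + q^(2*m) - q^(m+2) - q^m + q^2 - q + 1"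
      proof -
        have "n = 2 * m + 1" using odd by (simp add: m_def)
        then have "n + 1 = 2 * m + 2" "n - 1 = 2 * m" "(n + 3) div 2 = m + 2" "(n - 1) div 2 = m" by auto
        moreover have "q^n = q^(2*m+1)" using \<open>n = 2 * m + 1\<close> by simp
        ultimately show ?thesis using q2 unfolding G_def by simp
      qed
      \<comment> \<open>The jump cancels the terms \<open>- q^(m+2) - q^m\<close>, after which the
        sum factors.\<close>
      also have "\<dots> + (q^2 + 1) * q^m = (q^2 - q + 1) * (1 + q^(2*m))"
        by (simp add: algebra_simps power_add power2_eq_square)
      also have "2 * m = n - 1" using odd by (simp add: m_def)
      finally show "real (card (points (E_graph n) (\<lambda>_. Versal) M \<alpha>)) = (q^2 - q + 1) * (1 + q^(n-1))" .
    next
      assume gen: "generic_parameters (E_graph n) (\<lambda>_. Generic) M \<alpha>"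
      note \<alpha> = generic_parameters_E_graph[OF n odd M u gen]
      have vv: "versal_vertices (E_graph n) (\<lambda>_. Generic) M = {}"
        by (auto simp: versal_vertices_def)
      have "coefficient (E_graph n) (\<lambda>_. Generic) M \<alpha> \<beta> = (\<lambda>i. if i = u then \<alpha> u else 1)" for \<beta>
        unfolding coefficient_def u vv by auto
      then have "real (card (points (E_graph n) (\<lambda>_. Generic) M \<alpha>)) = G"
        unfolding points vv using weight[OF \<alpha>(1)] \<alpha>(2) by (simp add: m_def)
      then show "real (card (points (E_graph n) (\<lambda>_. Generic) M \<alpha>))
          = (q^(n+1) - q^n + q^(n-1) - q^((n+3) div 2) - q^((n-1) div 2) + q^2 - q + 1) / (q - 1)"
        unfolding G_def .
    }
  }
qed

end
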